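(* Let $R$ be a commutative ring with identity and suppose that $(A,B)$ is an algebraic quasi-Cartan pair over $R$. For each normaliser $n\in N(B)$, the set $\{e\in I(B):e\le n^\dagger n\text{ and }ne\in B\}$ contains a maximum element $e(n)$. If $P\colon A\to B$ is a conditional expectation that is implemented by idempotents, then $P(n)=n\,e(n)=e(n)\,n$ (for each $n\in N(B)$). In particular, there is a unique conditional expectation $P\colon A\to B$ that is implemented by idempotents. In general there can be many conditional expectations from $A$ to $B$ that are not implemented by idempotents.
   Context: Let $A$ be an $R$-algebra and $B\subseteq A$ a commutative subalgebra. $I(B)$ is the set of idempotents of $B$, ordered by $e\le f\iff ef=e$; it is a set of local units for $A$ if every finite $\{a_1,\dots,a_n\}\subseteq A$ admits $e\in I(B)$ with $ea_i=a_i=a_ie$ for all $i$. In that case the set of normalisers of $B$ is $N(B)=\{n\in A:\exists k\in A,\ knk=k,\ nkn=n,\ kBn\cup nBk\subseteq B\}$; for $n\in N(B)$ the element $k$ is unique, is denoted $n^\dagger$, and $n^\dagger n,nn^\dagger\in I(B)$. A conditional expectation $P\colon A\to B$ is an $R$-linear map with $P|_B=\mathrm{id}_B$ and $P(bab')=bP(a)b'$ for $a\in A$, $b,b'\in B$; it is faithful if for each $a\in A\setminus\{0\}$ there is $n\in N(B)$ with $P(na)\neq0$, and implemented by idempotents if for each $n\in N(B)$ there is $e\in I(B)$ with $P(n)=ne=en$. $(A,B)$ is an algebraic quasi-Cartan pair if: $t\in R$, $e\in I(B)\setminus\{0\}$, $te=0$ imply $t=0$; $I(B)$ is a set of local units for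 $A$; $B=\operatorname{span}_RI(B)$; $A=\operatorname{span}_RN(B)$; and there is a faithful conditional expectation $A\to B$ that is implemented by idempotents. *)

theory Defs
  imports "HOL-Algebra.Module" "HOL-Library.FuncSet"
begin

text \<open>
  The locale \<^locale>\<open>algebra\<close> of HOL-Algebra is about commutative unital algebras.  Here an
  \<open>R\<close>-algebra is associative, but neither commutative nor unital in general, so the field
  \<open>\<one>\<^bsub>A\<^esub>\<close> of the record \<open>A\<close> is never used.
\<close>

locale assoc_algebra = module R A for R (structure) and A (structure) +
  assumes mult_closed: "\<lbrakk>x \<in> carrier A; y \<in> carrier A\<rbrakk> \<Longrightarrow> x \<otimes>\<^bsub>A\<^esub> y \<in> carrier A"
    and mult_assoc: "\<lbrakk>x \<in> carrier A; y \<in> carrier A; z \<in> carrier A\<rbrakk> \<Longrightarrow>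
      (x \<otimes>\<^bsub>A\<^esub> y) \<otimes>\<^bsub>A\<^esub> z = x \<otimes>\<^bsub>A\<^esub> (y \<otimes>\<^bsub>A\<^esub> z)"
    and mult_l_distr: "\<lbrakk>x \<in> carrier A; y \<in> carrier A; z \<in> carrier A\<rbrakk> \<Longrightarrow>
      (x \<oplus>\<^bsub>A\<^esub> y) \<otimes>\<^bsub>A\<^esub> z = x \<otimes>\<^bsub>A\<^esub> z \<oplus>\<^bsub>A\<^esub> y \<otimes>\<^bsub>A\<^esub> z"
    and mult_r_distr: "\<lbrakk>x \<in> carrier A; y \<in> carrier A; z \<in> carrier A\<rbrakk> \<Longrightarrow>
      z \<otimes>\<^bsub>A\<^esub> (x \<oplus>\<^bsub>A\<^esub> y) = z \<otimes>\<^bsub>A\<^esub> x \<oplus>\<^bsub>A\<^esub> z \<otimes>\<^bsub>A\<^esub> y"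
    and smult_mult_l: "\<lbrakk>r \<in> carrier R; x \<in> carrier A; y \<in> carrier A\<rbrakk> \<Longrightarrow>
      (r \<odot>\<^bsub>A\<^esub> x) \<otimes>\<^bsub>A\<^esub> y = r \<odot>\<^bsub>A\<^esub> (x \<otimes>\<^bsub>A\<^esub> y)"
    and smult_mult_r: "\<lbrakk>r \<in> carrier R; x \<in> carrier A; y \<in> carrier A\<rbrakk> \<Longrightarrow>
      x \<otimes>\<^bsub>A\<^esub> (r \<odot>\<^bsub>A\<^esub> y) = r \<odot>\<^bsub>A\<^esub> (x \<otimes>\<^bsub>A\<^esub> y)"

locale comm_subalgebra = assoc_algebra R A + submodule B R A
  for R (structure) and A (structure) and B +
  assumes sub_mult_closed: "\<lbrakk>x \<in> B; y \<in> B\<rbrakk> \<Longrightarrow> x \<otimes>\<^bsub>A\<^esub> y \<in> B"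
    and sub_mult_comm: "\<lbrakk>x \<in> B; y \<in> B\<rbrakk> \<Longrightarrow> x \<otimes>\<^bsub>A\<^esub> y = y \<otimes>\<^bsub>A\<^esub> x"

definition lin_span :: "('r, 'm) ring_scheme \<Rightarrow> ('r, 'a, 'n) module_scheme \<Rightarrow> 'a set \<Rightarrow> 'a set"
  where "lin_span R A S =
    {\<Oplus>\<^bsub>A\<^esub>x\<in>F. c x \<odot>\<^bsub>A\<^esub> x | F c. finite F \<and> F \<subseteq> S \<and> c \<in> F \<rightarrow> carrier R}"

definition idems :: "('r, 'a, 'n) module_scheme \<Rightarrow> 'a set \<Rightarrow> 'a set"
  where "idems A B = {e \<in> B. e \<otimes>\<^bsub>A\<^esub> e = e}"

definition idem_order :: "('r, 'a, 'n) module_scheme \<Rightarrow> 'a set \<Rightarrow> 'a gorder"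
  where "idem_order A B =
    \<lparr>carrier = idems A B, eq = (=), le = (\<lambda>e f. e \<otimes>\<^bsub>A\<^esub> f = e)\<rparr>"

definition local_units :: "('r, 'a, 'n) module_scheme \<Rightarrow> 'a set \<Rightarrow> bool"
  where "local_units A E \<longleftrightarrow>
    (\<forall>F. finite F \<and> F \<subseteq> carrier A \<longrightarrow> (\<exists>e\<in>E. \<forall>a\<in>F. e \<otimes>\<^bsub>A\<^esub> a = a \<and> a \<otimes>\<^bsub>A\<^esub> e = a))"

definition is_dagger :: "('r, 'a, 'n) module_scheme \<Rightarrow> 'a set \<Rightarrow> 'a \<Rightarrow> 'a \<Rightarrow> bool"
  where "is_dagger A B n k \<longleftrightarrow> k \<in> carrier A \<and>
    k \<otimes>\<^bsub>A\<^esub> n \<otimes>\<^bsub>A\<^esub> k = k \<and> n \<otimes>\<^bsub>A\<^esub> k \<otimes>\<^bsub>A\<^esub> n = n \<and>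
    (\<forall>b\<in>B. k \<otimes>\<^bsub>A\<^esub> b \<otimes>\<^bsub>A\<^esub> n \<in> B \<and> n \<otimes>\<^bsub>A\<^esub> b \<otimes>\<^bsub>A\<^esub> k \<in> B)"

definition normalisers :: "('r, 'a, 'n) module_scheme \<Rightarrow> 'a set \<Rightarrow> 'a set"
  where "normalisers A B = {n \<in> carrier A. \<exists>k. is_dagger A B n k}"

text \<open>The element \<open>k\<close> is unique as soon as the idempotents of \<open>B\<close> are local units for \<open>A\<close>.\<close>

definition dagger :: "('r, 'a, 'n) module_scheme \<Rightarrow> 'a set \<Rightarrow> 'a \<Rightarrow> 'a"
  where "dagger A B n = (THE k. is_dagger A B n k)"

text \<open>
  A map \<open>A \<rightarrow> B\<close> is an element of \<open>carrier A \<rightarrow>\<^sub>E B\<close>, so that two such maps are equal iff they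
  agree on \<open>carrier A\<close>; this matters when maps are counted.
\<close>

definition cond_expectation ::
  "('r, 'm) ring_scheme \<Rightarrow> ('r, 'a, 'n) module_scheme \<Rightarrow> 'a set \<Rightarrow> ('a \<Rightarrow> 'a) \<Rightarrow> bool"
  where "cond_expectation R A B P \<longleftrightarrow> P \<in> carrier A \<rightarrow>\<^sub>E B \<and>
    (\<forall>x\<in>carrier A. \<forall>y\<in>carrier A. P (x \<oplus>\<^bsub>A\<^esub> y) = P x \<oplus>\<^bsub>A\<^esub> P y) \<and>
    (\<forall>r\<in>carrier R. \<forall>x\<in>carrier A. P (r \<odot>\<^bsub>A\<^esub> x) = r \<odot>\<^bsub>A\<^esub> P x) \<and>
    (\<forall>b\<in>B. P b = b) \<and>
    (\<forall>a\<in>carrier A. \<forall>b\<in>B. \<forall>b'\<in>B. P (b \<otimes>\<^bsub>A\<^esub> a \<otimes>\<^bsub>A\<^esub> b') = b \<otimes>\<^bsub>A\<^esub> P a \<otimes>\<^bsub>A\<^esub> b')"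

definition faithful :: "('r, 'a, 'n) module_scheme \<Rightarrow> 'a set \<Rightarrow> ('a \<Rightarrow> 'a) \<Rightarrow> bool"
  where "faithful A B P \<longleftrightarrow>
    (\<forall>a\<in>carrier A - {\<zero>\<^bsub>A\<^esub>}. \<exists>n\<in>normalisers A B. P (n \<otimes>\<^bsub>A\<^esub> a) \<noteq> \<zero>\<^bsub>A\<^esub>)"

definition implemented_by_idems :: "('r, 'a, 'n) module_scheme \<Rightarrow> 'a set \<Rightarrow> ('a \<Rightarrow> 'a) \<Rightarrow> bool"
  where "implemented_by_idems A B P \<longleftrightarrow>
    (\<forall>n\<in>normalisers A B. \<exists>e\<in>idems A B. P n = n \<otimes>\<^bsub>A\<^esub> e \<and> P n = e \<otimes>\<^bsub>A\<^esub> n)"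

locale quasi_Cartan_pair = comm_subalgebra R A B
  for R (structure) and A (structure) and B +
  assumes torsion_free:
      "\<lbrakk>t \<in> carrier R; e \<in> idems A B - {\<zero>\<^bsub>A\<^esub>}; t \<odot>\<^bsub>A\<^esub> e = \<zero>\<^bsub>A\<^esub>\<rbrakk> \<Longrightarrow> t = \<zero>\<^bsub>R\<^esub>"
    and local_units: "local_units A (idems A B)"
    and span_idems: "B = lin_span R A (idems A B)"
    and span_normalisers: "carrier A = lin_span R A (normalisers A B)"
    and faithful_implemented_expectation:
      "\<exists>P. cond_expectation R A B P \<and> faithful A B P \<and> implemented_by_idems A B P"

definition admissible_idems :: "('r, 'a, 'n) module_scheme \<Rightarrow> 'a set \<Rightarrow> 'a \<Rightarrow> 'a set"
  where "admissible_idems A B n =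
    {e \<in> idems A B. e \<sqsubseteq>\<^bsub>idem_order A B\<^esub> dagger A B n \<otimes>\<^bsub>A\<^esub> n \<and> n \<otimes>\<^bsub>A\<^esub> e \<in> B}"

definition max_idem :: "('r, 'a, 'n) module_scheme \<Rightarrow> 'a set \<Rightarrow> 'a \<Rightarrow> 'a"
  where "max_idem A B n = (THE e. greatest (idem_order A B) e (admissible_idems A B n))"

end

theory Submission
  imports Defs "HOL-Algebra.IntRing"
begin

text \<open>
  Let \<open>n\<close> be a normaliser with partial inverse \<open>n\<^sup>\<dagger>\<close>, and let \<open>P\<close> be implemented by idempotents,
  say \<open>P n = n e = e n\<close>.  The source projection \<open>n\<^sup>\<dagger> n\<close> lies in \<open>B\<close>, so \<open>f = e (n\<^sup>\<dagger> n)\<close> is an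
  idempotent below it, and \<open>n f = n e = P n \<in> B\<close>: \<open>f\<close> competes for the maximum.  It wins because
  \<open>P\<close> fixes \<open>B\<close>: if \<open>g \<le> n\<^sup>\<dagger> n\<close> and \<open>n g \<in> B\<close>, then \<open>n g = P (n g) = P n g = n e g\<close>, and
  multiplying by \<open>n\<^sup>\<dagger>\<close> on the left gives \<open>g = f g\<close>.  Hence the maximum is \<open>f\<close>, whichever \<open>P\<close> and
  \<open>e\<close> it was computed from, and \<open>P n\<close> is determined by \<open>n\<close>
  (\<open>implementing_idem_greatest\<close>, \<open>expectation_eq_max_idem\<close>).  As normalisers span \<open>A\<close>, this
  determines \<open>P\<close> (\<open>expectation_eqI\<close>); existence is part of the definition of a quasi-Cartan pair.

  For the failure of uniqueness without implementation, take the integral group ring of the group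
  \<open>{1, g}\<close> of order two, with \<open>B = \<int> \<cdot> 1\<close>.  A \<open>B\<close>-bimodule map is merely a \<open>\<int>\<close>-linear map, so for
  every integer \<open>m\<close> the assignment \<open>1 \<mapsto> 1\<close>, \<open>g \<mapsto> m\<close> is a conditional expectation.  The only
  idempotents of \<open>B\<close> are \<open>0\<close> and \<open>1\<close>, and \<open>g\<close> is a normaliser outside \<open>B\<close>, so implementation forces
  \<open>m = 0\<close>.  Conversely \<open>m = 0\<close> is implemented because \<open>\<plusminus>1\<close> and \<open>\<plusminus>g\<close> are the only nonzero
  normalisers (\<open>C2_normalisers_cases\<close>).
\<close>

section \<open>Normalisers of a subalgebra with local units\<close>

locale locally_unital_pair = comm_subalgebra R A B
  for R (structure) and A (structure) and B +
  assumes idems_local_units: "local_units A (idems A B)"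

sublocale quasi_Cartan_pair \<subseteq> locally_unital_pair
  by unfold_locales (rule local_units)

context comm_subalgebra
begin

lemma sub_carrier: "b \<in> B \<Longrightarrow> b \<in> carrier A"
  using subset by auto

lemma idems_mem: "e \<in> idems A B \<Longrightarrow> e \<in> B"
  by (simp add: idems_def)

lemma idems_carrier: "e \<in> idems A B \<Longrightarrow> e \<in> carrier A"
  by (simp add: idems_mem sub_carrier)

lemma idems_idem: "e \<in> idems A B \<Longrightarrow> e \<otimes>\<^bsub>A\<^esub> e = e"
  by (simp add: idems_def)

lemma idems_commute:
  "e \<in> idems A B \<Longrightarrow> f \<in> idems A B \<Longrightarrow> e \<otimes>\<^bsub>A\<^esub> f = f \<otimes>\<^bsub>A\<^esub> e"
  by (simp add: idems_mem sub_mult_comm)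

lemma idems_mult_closed:
  assumes "e \<in> idems A B" "f \<in> idems A B"
  shows "e \<otimes>\<^bsub>A\<^esub> f \<in> idems A B"
proof -
  note c = idems_carrier[OF assms(1)] idems_carrier[OF assms(2)]
  have "(e \<otimes>\<^bsub>A\<^esub> f) \<otimes>\<^bsub>A\<^esub> (e \<otimes>\<^bsub>A\<^esub> f) = e \<otimes>\<^bsub>A\<^esub> ((f \<otimes>\<^bsub>A\<^esub> e) \<otimes>\<^bsub>A\<^esub> f)"
    using c by (simp add: mult_assoc mult_closed)
  also have "\<dots> = e \<otimes>\<^bsub>A\<^esub> ((e \<otimes>\<^bsub>A\<^esub> f) \<otimes>\<^bsub>A\<^esub> f)"
    using assms by (simp add: idems_commute)
  also have "\<dots> = (e \<otimes>\<^bsub>A\<^esub> e) \<otimes>\<^bsub>A\<^esub> (f \<otimes>\<^bsub>A\<^esub> f)"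
    using c by (simp add: mult_assoc mult_closed)
  finally show ?thesis
    using assms by (simp add: idems_def sub_mult_closed)
qed

lemma greatest_idem_unique:
  assumes "greatest (idem_order A B) e S" "greatest (idem_order A B) f S"
  shows "e = f"
proof -
  have "e \<in> idems A B" "f \<in> idems A B" "e \<otimes>\<^bsub>A\<^esub> f = e" "f \<otimes>\<^bsub>A\<^esub> e = f"
    using assms by (auto simp: greatest_def idem_order_def)
  then show ?thesis
    using idems_commute by metis
qed

end

context locally_unital_pair
begin

lemma obtain_local_unit:
  assumes "a \<in> carrier A"
  obtains e where "e \<in> idems A B" "e \<otimes>\<^bsub>A\<^esub> a = a" "a \<otimes>\<^bsub>A\<^esub> e = a"
proof -
  have "finite {a} \<and> {a} \<subseteq> carrier A"
    using assms by simp
  then show ?thesis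
    using idems_local_units that unfolding local_units_def by blast
qed

text \<open>
  The normaliser condition places only \<open>k b n\<close> with \<open>b \<in> B\<close> in \<open>B\<close>; a local unit \<open>b\<close> of \<open>n\<close> turns
  this into \<open>k n\<close>.
\<close>

lemma dagger_mult_idem:
  assumes n: "n \<in> carrier A" and k: "is_dagger A B n k"
  shows "k \<otimes>\<^bsub>A\<^esub> n \<in> idems A B" and "n \<otimes>\<^bsub>A\<^esub> k \<in> idems A B"
proof -
  have kc: "k \<in> carrier A" and knk: "k \<otimes>\<^bsub>A\<^esub> n \<otimes>\<^bsub>A\<^esub> k = k" and nkn: "n \<otimes>\<^bsub>A\<^esub> k \<otimes>\<^bsub>A\<^esub> n = n"
    and conj: "\<And>b. b \<in> B \<Longrightarrow> k \<otimes>\<^bsub>A\<^esub> b \<otimes>\<^bsub>A\<^esub> n \<in> B" "\<And>b. b \<in> B \<Longrightarrow> n \<otimes>\<^bsub>A\<^esub> b \<otimes>\<^bsub>A\<^esub> k \<in> B"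
    using k by (auto simp: is_dagger_def)
  obtain e where e: "e \<in> idems A B" "n \<otimes>\<^bsub>A\<^esub> e = n" "e \<otimes>\<^bsub>A\<^esub> n = n"
    using obtain_local_unit[OF n] by metis
  have "k \<otimes>\<^bsub>A\<^esub> n \<in> B"
    using conj(1)[OF idems_mem[OF e(1)]] e idems_carrier[OF e(1)] kc n
    by (simp add: mult_assoc)
  moreover have "n \<otimes>\<^bsub>A\<^esub> k \<in> B"
    using conj(2)[OF idems_mem[OF e(1)]] e by simp
  moreover have "(k \<otimes>\<^bsub>A\<^esub> n) \<otimes>\<^bsub>A\<^esub> (k \<otimes>\<^bsub>A\<^esub> n) = k \<otimes>\<^bsub>A\<^esub> n"
    using mult_assoc[of "k \<otimes>\<^bsub>A\<^esub> n" k n] knk kc n by (simp add: mult_closed)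
  moreover have "(n \<otimes>\<^bsub>A\<^esub> k) \<otimes>\<^bsub>A\<^esub> (n \<otimes>\<^bsub>A\<^esub> k) = n \<otimes>\<^bsub>A\<^esub> k"
    using mult_assoc[of "n \<otimes>\<^bsub>A\<^esub> k" n k] nkn kc n by (simp add: mult_closed)
  ultimately show "k \<otimes>\<^bsub>A\<^esub> n \<in> idems A B" "n \<otimes>\<^bsub>A\<^esub> k \<in> idems A B"
    by (simp_all add: idems_def)
qed

text \<open>
  The argument for inverse semigroups: the source projections \<open>k n\<close> and \<open>l n\<close> are commuting
  idempotents, each below the other because \<open>n l n = n = n k n\<close>, so they agree, and likewise for
  the range projections \<open>n k\<close> and \<open>n l\<close>.  Hence \<open>k = k n k = l n k = l n l = l\<close>.
\<close>

lemma is_dagger_unique: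
  assumes n: "n \<in> carrier A" and k: "is_dagger A B n k" and l: "is_dagger A B n l"
  shows "k = l"
proof -
  have c: "k \<in> carrier A" "l \<in> carrier A"
    and k': "k \<otimes>\<^bsub>A\<^esub> n \<otimes>\<^bsub>A\<^esub> k = k" "n \<otimes>\<^bsub>A\<^esub> k \<otimes>\<^bsub>A\<^esub> n = n"
    and l': "l \<otimes>\<^bsub>A\<^esub> n \<otimes>\<^bsub>A\<^esub> l = l" "n \<otimes>\<^bsub>A\<^esub> l \<otimes>\<^bsub>A\<^esub> n = n"
    using k l by (auto simp: is_dagger_def)
  note assoc = mult_assoc mult_closed
  have "k \<otimes>\<^bsub>A\<^esub> n = (k \<otimes>\<^bsub>A\<^esub> n) \<otimes>\<^bsub>A\<^esub> (l \<otimes>\<^bsub>A\<^esub> n)"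
    using l'(2) n c by (simp add: assoc)
  also have "\<dots> = (l \<otimes>\<^bsub>A\<^esub> n) \<otimes>\<^bsub>A\<^esub> (k \<otimes>\<^bsub>A\<^esub> n)"
    by (rule idems_commute[OF dagger_mult_idem(1)[OF n k] dagger_mult_idem(1)[OF n l]])
  also have "\<dots> = l \<otimes>\<^bsub>A\<^esub> n"
    using k'(2) n c by (simp add: assoc)
  finally have source: "k \<otimes>\<^bsub>A\<^esub> n = l \<otimes>\<^bsub>A\<^esub> n" .
  have "n \<otimes>\<^bsub>A\<^esub> k = (n \<otimes>\<^bsub>A\<^esub> l) \<otimes>\<^bsub>A\<^esub> (n \<otimes>\<^bsub>A\<^esub> k)"
    using mult_assoc[of "n \<otimes>\<^bsub>A\<^esub> l" n k] l'(2) n c by (simp add: mult_closed)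
  also have "\<dots> = (n \<otimes>\<^bsub>A\<^esub> k) \<otimes>\<^bsub>A\<^esub> (n \<otimes>\<^bsub>A\<^esub> l)"
    by (rule idems_commute[OF dagger_mult_idem(2)[OF n l] dagger_mult_idem(2)[OF n k]])
  also have "\<dots> = n \<otimes>\<^bsub>A\<^esub> l"
    using mult_assoc[of "n \<otimes>\<^bsub>A\<^esub> k" n l] k'(2) n c by (simp add: mult_closed)
  finally have range: "n \<otimes>\<^bsub>A\<^esub> k = n \<otimes>\<^bsub>A\<^esub> l" .
  have "k = l \<otimes>\<^bsub>A\<^esub> n \<otimes>\<^bsub>A\<^esub> k"
    using k'(1) source by simp
  also have "\<dots> = l \<otimes>\<^bsub>A\<^esub> n \<otimes>\<^bsub>A\<^esub> l"
    using range n c by (simp add: assoc)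
  finally show ?thesis
    using l'(1) by simp
qed

lemma normaliser_carrier: "n \<in> normalisers A B \<Longrightarrow> n \<in> carrier A"
  by (simp add: normalisers_def)

lemma is_dagger_dagger:
  assumes "n \<in> normalisers A B"
  shows "is_dagger A B n (dagger A B n)"
proof -
  obtain k where "is_dagger A B n k"
    using assms by (auto simp: normalisers_def)
  then show ?thesis
    unfolding dagger_def
    using is_dagger_unique[OF normaliser_carrier[OF assms]] by (metis theI)
qed

section \<open>The maximum idempotent computed by an implemented expectation\<close>

text \<open>
  The bimodule property has factors from \<open>B\<close> on both sides; for a one-sided factor, the other
  side is filled with a common local unit of \<open>a\<close> and \<open>P a\<close>.
\<close>

lemma expectation_mult_right:
  assumes P: "cond_expectation R A B P" and a: "a \<in> carrier A" and b: "b \<in> B"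
  shows "P (a \<otimes>\<^bsub>A\<^esub> b) = P a \<otimes>\<^bsub>A\<^esub> b"
proof -
  have PaB: "P a \<in> B"
    using P a by (auto simp: cond_expectation_def)
  then have "finite {a, P a} \<and> {a, P a} \<subseteq> carrier A"
    using a sub_carrier by simp
  then obtain u where u: "u \<in> idems A B" "u \<otimes>\<^bsub>A\<^esub> a = a" "u \<otimes>\<^bsub>A\<^esub> P a = P a"
    using idems_local_units unfolding local_units_def by (meson insertCI)
  have "P (u \<otimes>\<^bsub>A\<^esub> a \<otimes>\<^bsub>A\<^esub> b) = u \<otimes>\<^bsub>A\<^esub> P a \<otimes>\<^bsub>A\<^esub> b"
    using P a b idems_mem[OF u(1)] by (auto simp: cond_expectation_def)
  then show ?thesis
    using u by simp
qed

lemma implementing_idem_greatest: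
  assumes P: "cond_expectation R A B P" and n: "n \<in> normalisers A B"
    and e: "e \<in> idems A B" and Pne: "P n = n \<otimes>\<^bsub>A\<^esub> e" and Pen: "P n = e \<otimes>\<^bsub>A\<^esub> n"
  defines "f \<equiv> e \<otimes>\<^bsub>A\<^esub> (dagger A B n \<otimes>\<^bsub>A\<^esub> n)"
  shows "greatest (idem_order A B) f (admissible_idems A B n)"
    and "P n = n \<otimes>\<^bsub>A\<^esub> f" and "P n = f \<otimes>\<^bsub>A\<^esub> n"
proof -
  let ?k = "dagger A B n"
  let ?s = "?k \<otimes>\<^bsub>A\<^esub> n"
  note nc = normaliser_carrier[OF n]
  note dag = is_dagger_dagger[OF n]
  have kc: "?k \<in> carrier A" and nkn: "n \<otimes>\<^bsub>A\<^esub> ?k \<otimes>\<^bsub>A\<^esub> n = n"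
    using dag by (auto simp: is_dagger_def)
  have s: "?s \<in> idems A B"
    by (rule dagger_mult_idem(1)[OF nc dag])
  note ec = idems_carrier[OF e] and sc = idems_carrier[OF s]
  have ns: "n \<otimes>\<^bsub>A\<^esub> ?s = n"
    using nkn nc kc by (simp add: mult_assoc)
  have f: "f \<in> idems A B"
    unfolding f_def by (rule idems_mult_closed[OF e s])
  have f': "f = ?s \<otimes>\<^bsub>A\<^esub> e"
    unfolding f_def by (rule idems_commute[OF e s])
  have PB: "P n \<in> B"
    using P nc by (auto simp: cond_expectation_def)
  have "n \<otimes>\<^bsub>A\<^esub> f = (n \<otimes>\<^bsub>A\<^esub> ?s) \<otimes>\<^bsub>A\<^esub> e"
    unfolding f' using mult_assoc[OF nc sc ec] by simp
  then show nf: "P n = n \<otimes>\<^bsub>A\<^esub> f"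
    using ns Pne by simp
  have "f \<otimes>\<^bsub>A\<^esub> n = ?s \<otimes>\<^bsub>A\<^esub> P n"
    unfolding f' Pen by (rule mult_assoc[OF sc ec nc])
  also have "\<dots> = P n \<otimes>\<^bsub>A\<^esub> ?s"
    by (rule sub_mult_comm[OF idems_mem[OF s] PB])
  also have "\<dots> = e \<otimes>\<^bsub>A\<^esub> (n \<otimes>\<^bsub>A\<^esub> ?s)"
    unfolding Pen by (rule mult_assoc[OF ec nc sc])
  finally show "P n = f \<otimes>\<^bsub>A\<^esub> n"
    using ns Pen by simp
  have "f \<otimes>\<^bsub>A\<^esub> ?s = f"
    unfolding f_def using mult_assoc[OF ec sc sc] idems_idem[OF s] by simp
  then have "f \<in> admissible_idems A B n"
    using f nf PB by (simp add: admissible_idems_def idem_order_def)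
  moreover have "g \<otimes>\<^bsub>A\<^esub> f = g" if g: "g \<in> admissible_idems A B n" for g
  proof -
    have gI: "g \<in> idems A B" and gs: "g \<otimes>\<^bsub>A\<^esub> ?s = g" and ngB: "n \<otimes>\<^bsub>A\<^esub> g \<in> B"
      using g by (auto simp: admissible_idems_def idem_order_def)
    note gc = idems_carrier[OF gI]
    have "n \<otimes>\<^bsub>A\<^esub> g = P (n \<otimes>\<^bsub>A\<^esub> g)"
      using P ngB by (simp add: cond_expectation_def)
    also have "\<dots> = (n \<otimes>\<^bsub>A\<^esub> e) \<otimes>\<^bsub>A\<^esub> g"
      using expectation_mult_right[OF P nc idems_mem[OF gI]] Pne by simp
    finally have ng: "n \<otimes>\<^bsub>A\<^esub> g = (n \<otimes>\<^bsub>A\<^esub> e) \<otimes>\<^bsub>A\<^esub> g" .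
    have "g = ?s \<otimes>\<^bsub>A\<^esub> g"
      using gs idems_commute[OF gI s] by simp
    also have "\<dots> = ?k \<otimes>\<^bsub>A\<^esub> (n \<otimes>\<^bsub>A\<^esub> g)"
      by (rule mult_assoc[OF kc nc gc])
    also have "\<dots> = f \<otimes>\<^bsub>A\<^esub> g"
      unfolding ng f' using kc nc ec gc by (simp add: mult_assoc mult_closed)
    also have "\<dots> = g \<otimes>\<^bsub>A\<^esub> f"
      by (rule idems_commute[OF f gI])
    finally show ?thesis
      by (rule sym)
  qed
  ultimately show "greatest (idem_order A B) f (admissible_idems A B n)"
    by (auto simp: greatest_def idem_order_def admissible_idems_def)
qed

lemma expectation_eq_max_idem:
  assumes P: "cond_expectation R A B P" "implemented_by_idems A B P" and n: "n \<in> normalisers A B"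
  shows "greatest (idem_order A B) (max_idem A B n) (admissible_idems A B n)"
    and "P n = n \<otimes>\<^bsub>A\<^esub> max_idem A B n" and "P n = max_idem A B n \<otimes>\<^bsub>A\<^esub> n"
proof -
  obtain e where e: "e \<in> idems A B" "P n = n \<otimes>\<^bsub>A\<^esub> e" "P n = e \<otimes>\<^bsub>A\<^esub> n"
    using P(2) n by (auto simp: implemented_by_idems_def)
  note f = implementing_idem_greatest[OF P(1) n e]
  have "max_idem A B n = e \<otimes>\<^bsub>A\<^esub> (dagger A B n \<otimes>\<^bsub>A\<^esub> n)"
    unfolding max_idem_def using f(1) greatest_idem_unique by (metis the_equality)
  then show "greatest (idem_order A B) (max_idem A B n) (admissible_idems A B n)"
    "P n = n \<otimes>\<^bsub>A\<^esub> max_idem A B n" "P n = max_idem A B n \<otimes>\<^bsub>A\<^esub> n"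
    using f by simp_all
qed

end

section \<open>Uniqueness by linearity\<close>

context comm_subalgebra
begin

lemma expectation_finsum:
  assumes P: "cond_expectation R A B P" and "finite F" "F \<subseteq> carrier A" "c \<in> F \<rightarrow> carrier R"
  shows "P (\<Oplus>\<^bsub>A\<^esub>x\<in>F. c x \<odot>\<^bsub>A\<^esub> x) = (\<Oplus>\<^bsub>A\<^esub>x\<in>F. c x \<odot>\<^bsub>A\<^esub> P x)"
  using assms(2-)
proof (induction F)
  case empty
  have "\<zero>\<^bsub>A\<^esub> \<in> B"
    using one_closed by simp
  then show ?case
    using P by (simp add: cond_expectation_def)
next
  case (insert y F)
  have PB: "\<And>x. x \<in> carrier A \<Longrightarrow> P x \<in> carrier A"
    using P sub_carrier by (auto simp: cond_expectation_def)
  have c: "y \<in> carrier A" "F \<subseteq> carrier A" "c y \<in> carrier R" "\<And>x. x \<in> F \<Longrightarrow> c x \<in> carrier R"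
    using insert.prems by auto
  have cl: "(\<lambda>x. c x \<odot>\<^bsub>A\<^esub> x) \<in> F \<rightarrow> carrier A" "(\<lambda>x. c x \<odot>\<^bsub>A\<^esub> P x) \<in> F \<rightarrow> carrier A"
    using c(2,4) PB by auto
  have "P (\<Oplus>\<^bsub>A\<^esub>x\<in>insert y F. c x \<odot>\<^bsub>A\<^esub> x) = P (c y \<odot>\<^bsub>A\<^esub> y \<oplus>\<^bsub>A\<^esub> (\<Oplus>\<^bsub>A\<^esub>x\<in>F. c x \<odot>\<^bsub>A\<^esub> x))"
    using insert.hyps c cl by simp
  also have "\<dots> = c y \<odot>\<^bsub>A\<^esub> P y \<oplus>\<^bsub>A\<^esub> P (\<Oplus>\<^bsub>A\<^esub>x\<in>F. c x \<odot>\<^bsub>A\<^esub> x)"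
    using P c cl by (simp add: cond_expectation_def)
  also have "\<dots> = (\<Oplus>\<^bsub>A\<^esub>x\<in>insert y F. c x \<odot>\<^bsub>A\<^esub> P x)"
    using insert c cl PB by simp
  finally show ?case .
qed

lemma expectation_eqI:
  assumes P: "cond_expectation R A B P" and Q: "cond_expectation R A B Q"
    and S: "S \<subseteq> carrier A" and span: "carrier A = lin_span R A S"
    and agree: "\<And>x. x \<in> S \<Longrightarrow> P x = Q x"
  shows "P = Q"
proof (rule PiE_ext)
  show "P \<in> carrier A \<rightarrow>\<^sub>E B" "Q \<in> carrier A \<rightarrow>\<^sub>E B"
    using P Q by (simp_all add: cond_expectation_def)
next
  fix a assume "a \<in> carrier A"
  then obtain F c where F: "finite F" "F \<subseteq> S" "c \<in> F \<rightarrow> carrier R"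
    and a: "a = (\<Oplus>\<^bsub>A\<^esub>x\<in>F. c x \<odot>\<^bsub>A\<^esub> x)"
    using span by (auto simp: lin_span_def)
  have Fc: "F \<subseteq> carrier A"
    using F(2) S by blast
  have "(\<Oplus>\<^bsub>A\<^esub>x\<in>F. c x \<odot>\<^bsub>A\<^esub> P x) = (\<Oplus>\<^bsub>A\<^esub>x\<in>F. c x \<odot>\<^bsub>A\<^esub> Q x)"
  proof (rule M.finsum_cong')
    show "(\<lambda>x. c x \<odot>\<^bsub>A\<^esub> Q x) \<in> F \<rightarrow> carrier A"
      using Q F(3) Fc sub_carrier by (auto simp: cond_expectation_def Pi_iff PiE_iff subset_iff)
  qed (use F(2) agree in auto)
  then show "P a = Q a"
    using expectation_finsum[OF P F(1) Fc F(3)] expectation_finsum[OF Q F(1) Fc F(3)] a by simp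
qed

end

lemma (in quasi_Cartan_pair) ex1_implemented_expectation:
  "\<exists>!P. cond_expectation R A B P \<and> implemented_by_idems A B P"
proof (rule ex_ex1I)
  show "\<exists>P. cond_expectation R A B P \<and> implemented_by_idems A B P"
    using faithful_implemented_expectation by blast
next
  fix P Q
  assume P: "cond_expectation R A B P \<and> implemented_by_idems A B P"
    and Q: "cond_expectation R A B Q \<and> implemented_by_idems A B Q"
  show "P = Q"
  proof (rule expectation_eqI[OF _ _ _ span_normalisers])
    fix n assume "n \<in> normalisers A B"
    then have "P n = n \<otimes>\<^bsub>A\<^esub> max_idem A B n" "Q n = n \<otimes>\<^bsub>A\<^esub> max_idem A B n"
      using P Q expectation_eq_max_idem(2) by blast+
    then show "P n = Q n"
      by simp
  qed (use P Q normaliser_carrier in blast)+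
qed

section \<open>The integral group ring of the group of order two\<close>

text \<open>The pair \<open>(a, b)\<close> stands for \<open>a + b g\<close>, where \<open>g\<close> is the generator and \<open>g\<^sup>2 = 1\<close>.\<close>

definition C2_ring :: "(int, int \<times> int) module" where
  "C2_ring = \<lparr>carrier = UNIV,
    monoid.mult = (\<lambda>x y. (fst x * fst y + snd x * snd y, fst x * snd y + snd x * fst y)),
    one = (1, 0), zero = (0, 0), add = (\<lambda>x y. (fst x + fst y, snd x + snd y)),
    smult = (\<lambda>r x. (r * fst x, r * snd x))\<rparr>"

definition C2_scalars :: "(int \<times> int) set" where
  "C2_scalars = {x. snd x = 0}"

definition C2_expectation :: "int \<Rightarrow> int \<times> int \<Rightarrow> int \<times> int" where
  "C2_expectation m x = (fst x + m * snd x, 0)"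

lemma C2_ring_simps [simp]:
  "carrier C2_ring = UNIV" "\<zero>\<^bsub>C2_ring\<^esub> = (0, 0)"
  "(a, b) \<otimes>\<^bsub>C2_ring\<^esub> (c, d) = (a * c + b * d, a * d + b * c)"
  "(a, b) \<oplus>\<^bsub>C2_ring\<^esub> (c, d) = (a + c, b + d)"
  "r \<odot>\<^bsub>C2_ring\<^esub> (a, b) = (r * a, r * b)"
  by (simp_all add: C2_ring_def)

lemma C2_module: "module \<Z> C2_ring"
proof (rule moduleI)
  show "abelian_group C2_ring"
  proof (rule abelian_groupI)
    fix x assume "x \<in> carrier C2_ring"
    show "\<exists>y\<in>carrier C2_ring. y \<oplus>\<^bsub>C2_ring\<^esub> x = \<zero>\<^bsub>C2_ring\<^esub>"
      by (rule bexI[of _ "(- fst x, - snd x)"]) (cases x; simp)+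
  qed auto
qed (auto simp: int_is_cring algebra_simps)

lemma C2_comm_subalgebra: "comm_subalgebra \<Z> C2_ring C2_scalars"
proof -
  interpret module \<Z> C2_ring
    by (rule C2_module)
  have "\<ominus>\<^bsub>C2_ring\<^esub> (a, 0) = (- a, 0)" for a
    by (rule M.minus_equality) auto
  then have "submodule C2_scalars \<Z> C2_ring"
    by (intro submoduleI) (auto simp: C2_scalars_def)
  then show ?thesis
    by (intro comm_subalgebra.intro assoc_algebra.intro C2_module
        assoc_algebra_axioms.intro comm_subalgebra_axioms.intro)
      (auto simp: C2_scalars_def algebra_simps)
qed

lemma C2_idems: "idems C2_ring C2_scalars = {(0, 0), (1, 0)}"
  by (auto simp: idems_def C2_scalars_def)

lemma C2_smult_mem_lin_span:
  assumes "x \<in> S" shows "r \<odot>\<^bsub>C2_ring\<^esub> x \<in> lin_span \<Z> C2_ring S"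
proof -
  interpret module \<Z> C2_ring
    by (rule C2_module)
  have "r \<odot>\<^bsub>C2_ring\<^esub> x = (\<Oplus>\<^bsub>C2_ring\<^esub>y\<in>{x}. r \<odot>\<^bsub>C2_ring\<^esub> y)"
    by simp
  then show ?thesis
    unfolding lin_span_def using assms
    by (intro CollectI exI[of _ "{x}"] exI[of _ "\<lambda>_. r"]) auto
qed

lemma C2_one_normaliser: "(1, 0) \<in> normalisers C2_ring C2_scalars"
  by (auto simp: normalisers_def is_dagger_def C2_scalars_def intro!: exI[of _ "1::int"] exI[of _ "0::int"])

lemma C2_generator_normaliser: "(0, 1) \<in> normalisers C2_ring C2_scalars"
  by (auto simp: normalisers_def is_dagger_def C2_scalars_def intro!: exI[of _ "1::int"] exI[of _ "0::int"])

text \<open>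
  The scalar \<open>n\<^sup>\<dagger> n\<close> fixes \<open>n\<close>, so it is \<open>1\<close> unless \<open>n = 0\<close>: nonzero normalisers are units.  The
  characters \<open>g \<mapsto> 1\<close> and \<open>g \<mapsto> -1\<close> send a unit \<open>a + b g\<close> to the units \<open>a + b\<close> and \<open>a - b\<close> of
  \<open>\<int>\<close>, which leaves only the four units \<open>\<plusminus>1\<close> and \<open>\<plusminus>g\<close>.
\<close>

lemma C2_normalisers_cases:
  assumes "n \<in> normalisers C2_ring C2_scalars"
  shows "n \<in> {(0, 0), (1, 0), (- 1, 0), (0, 1), (0, - 1)}"
proof -
  obtain a b where n: "n = (a, b)"
    by fastforce
  obtain c d where k: "is_dagger C2_ring C2_scalars n (c, d)"
    using assms by (auto simp: normalisers_def)
  have "\<forall>x\<in>C2_scalars. (c, d) \<otimes>\<^bsub>C2_ring\<^esub> x \<otimes>\<^bsub>C2_ring\<^esub> n \<in> C2_scalars"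
    using k by (simp add: is_dagger_def)
  from bspec[OF this, of "(1, 0)"] have scalar: "a * d + b * c = 0"
    by (simp add: n C2_scalars_def algebra_simps)
  have "(a, b) \<otimes>\<^bsub>C2_ring\<^esub> (c, d) \<otimes>\<^bsub>C2_ring\<^esub> (a, b) = (a, b)"
    using k by (simp add: n is_dagger_def)
  then have nkn: "(a * c + b * d) * a = a" "(a * c + b * d) * b = b"
    by (simp_all add: scalar)
  have "a * c + b * d = 1" if "n \<noteq> (0, 0)"
    using nkn that n by auto
  then have "(a + b) * (c + d) = 1" "(a - b) * (c - d) = 1" if "n \<noteq> (0, 0)"
    using scalar that by (auto simp: algebra_simps)
  then have "n = (0, 0) \<or> \<bar>a + b\<bar> = 1 \<and> \<bar>a - b\<bar> = 1"
    by (metis abs_1 abs_zmult_eq_1)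
  then show ?thesis
    unfolding n by (auto simp: abs_if split: if_splits)
qed

lemma C2_cond_expectation: "cond_expectation \<Z> C2_ring C2_scalars (C2_expectation m)"
  by (auto simp: cond_expectation_def C2_expectation_def C2_scalars_def algebra_simps)

lemma C2_quasi_Cartan_pair: "quasi_Cartan_pair \<Z> C2_ring C2_scalars"
proof -
  interpret comm_subalgebra \<Z> C2_ring C2_scalars
    by (rule C2_comm_subalgebra)
  show ?thesis
  proof
    show "local_units C2_ring (idems C2_ring C2_scalars)"
      unfolding local_units_def C2_idems by auto
  next
    have "(r, 0) \<in> lin_span \<Z> C2_ring (idems C2_ring C2_scalars)" for r
      using C2_smult_mem_lin_span[of "(1, 0)" _ r] by (simp add: C2_idems)
    moreover have "(\<Oplus>\<^bsub>C2_ring\<^esub>x\<in>F. c x \<odot>\<^bsub>C2_ring\<^esub> x) \<in> C2_scalars"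
      if "finite F" "F \<subseteq> idems C2_ring C2_scalars" for F c
      using that
    proof (induction F)
      case (insert x F)
      obtain a where "x = (a, 0)"
        using insert.prems by (auto simp: C2_idems)
      moreover obtain b where "(\<Oplus>\<^bsub>C2_ring\<^esub>x\<in>F. c x \<odot>\<^bsub>C2_ring\<^esub> x) = (b, 0)"
        using insert.IH insert.prems by (auto simp: C2_scalars_def prod_eq_iff)
      ultimately show ?case
        using insert.hyps by (simp add: C2_scalars_def)
    qed (simp add: C2_scalars_def)
    ultimately show "C2_scalars = lin_span \<Z> C2_ring (idems C2_ring C2_scalars)"
      by (auto simp: C2_scalars_def lin_span_def)
  next
    have "(a, b) \<in> lin_span \<Z> C2_ring (normalisers C2_ring C2_scalars)" for a b
    proof -
      let ?c = "\<lambda>x. if x = (1, 0) then a else b"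
      have "(a, b) = (\<Oplus>\<^bsub>C2_ring\<^esub>x\<in>{(1, 0), (0, 1)}. ?c x \<odot>\<^bsub>C2_ring\<^esub> x)"
        by simp
      then show ?thesis
        unfolding lin_span_def
        using C2_one_normaliser C2_generator_normaliser
        by (intro CollectI exI[of _ "{(1, 0), (0, 1)}"] exI[of _ ?c]) auto
    qed
    then show "carrier C2_ring = lin_span \<Z> C2_ring (normalisers C2_ring C2_scalars)"
      by auto
  next
    have "faithful C2_ring C2_scalars (C2_expectation 0)"
      unfolding faithful_def
    proof
      fix x assume x: "x \<in> carrier C2_ring - {\<zero>\<^bsub>C2_ring\<^esub>}"
      obtain a b where ab: "x = (a, b)"
        by fastforce
      \<comment> \<open>Multiplication by the generator swaps the two coefficients, so one of them is detected.\<close>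
      show "\<exists>n\<in>normalisers C2_ring C2_scalars.
        C2_expectation 0 (n \<otimes>\<^bsub>C2_ring\<^esub> x) \<noteq> \<zero>\<^bsub>C2_ring\<^esub>"
      proof (cases "a = 0")
        case True
        then show ?thesis
          using x by (intro bexI[OF _ C2_generator_normaliser]) (auto simp: ab C2_expectation_def)
      next
        case False
        then show ?thesis
          by (intro bexI[OF _ C2_one_normaliser]) (auto simp: ab C2_expectation_def)
      qed
    qed
    moreover have "implemented_by_idems C2_ring C2_scalars (C2_expectation 0)"
      unfolding implemented_by_idems_def C2_idems
      using C2_normalisers_cases by (fastforce simp: C2_expectation_def)
    ultimately show "\<exists>P. cond_expectation \<Z> C2_ring C2_scalars P \<and>
        faithful C2_ring C2_scalars P \<and> implemented_by_idems C2_ring C2_scalars P"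
      using C2_cond_expectation by blast
  qed (auto simp: C2_idems)
qed

lemma C2_not_implemented:
  assumes "m \<noteq> 0"
  shows "\<not> implemented_by_idems C2_ring C2_scalars (C2_expectation m)"
proof
  assume "implemented_by_idems C2_ring C2_scalars (C2_expectation m)"
  then obtain e where "e \<in> {(0, 0), (1, 0)}"
    and "C2_expectation m (0, 1) = (0, 1) \<otimes>\<^bsub>C2_ring\<^esub> e"
    using C2_generator_normaliser unfolding implemented_by_idems_def C2_idems by blast
  then show False
    using assms by (auto simp: C2_expectation_def)
qed

lemma C2_infinite_not_implemented:
  "infinite {P. cond_expectation \<Z> C2_ring C2_scalars P \<and>
    \<not> implemented_by_idems C2_ring C2_scalars P}"
proof -
  have "inj C2_expectation"
  proof (rule injI)
    fix m m' assume "C2_expectation m = C2_expectation m'"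
    then have "C2_expectation m (0, 1) = C2_expectation m' (0, 1)"
      by simp
    then show "m = m'"
      by (simp add: C2_expectation_def)
  qed
  then have "infinite (C2_expectation ` (- {0}))"
    by (simp add: finite_image_iff inj_on_subset infinite_UNIV_int)
  then show ?thesis
    by (rule infinite_super[rotated]) (auto simp: C2_cond_expectation C2_not_implemented)
qed

section \<open>The uniqueness theorem\<close>

theorem proposition3p7:
  fixes R :: "('r, 'm) ring_scheme" and A :: "('r, 'a, 'n) module_scheme" and B :: "'a set"
  shows "(quasi_Cartan_pair R A B \<longrightarrow>
      (\<forall>n\<in>normalisers A B.
        greatest (idem_order A B) (max_idem A B n) (admissible_idems A B n)) \<and>
      (\<forall>P. cond_expectation R A B P \<and> implemented_by_idems A B P \<longrightarrow>
        (\<forall>n\<in>normalisers A B.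
          P n = n \<otimes>\<^bsub>A\<^esub> max_idem A B n \<and> P n = max_idem A B n \<otimes>\<^bsub>A\<^esub> n)) \<and>
      (\<exists>!P. cond_expectation R A B P \<and> implemented_by_idems A B P)) \<and>
    (\<exists>(R' :: int ring) (A' :: (int, int \<times> int) module) B'.
      quasi_Cartan_pair R' A' B' \<and>
      infinite {P. cond_expectation R' A' B' P \<and> \<not> implemented_by_idems A' B' P})"
proof (intro conjI impI)
  assume "quasi_Cartan_pair R A B"
  then interpret quasi_Cartan_pair R A B .
  show "\<forall>n\<in>normalisers A B.
      greatest (idem_order A B) (max_idem A B n) (admissible_idems A B n)"
    using faithful_implemented_expectation expectation_eq_max_idem(1) by blast
  show "\<forall>P. cond_expectation R A B P \<and> implemented_by_idems A B P \<longrightarrow>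
      (\<forall>n\<in>normalisers A B.
        P n = n \<otimes>\<^bsub>A\<^esub> max_idem A B n \<and> P n = max_idem A B n \<otimes>\<^bsub>A\<^esub> n)"
    using expectation_eq_max_idem(2,3) by blast
  show "\<exists>!P. cond_expectation R A B P \<and> implemented_by_idems A B P"
    by (rule ex1_implemented_expectation)
next
  show "\<exists>(R' :: int ring) (A' :: (int, int \<times> int) module) B'.
      quasi_Cartan_pair R' A' B' \<and>
      infinite {P. cond_expectation R' A' B' P \<and> \<not> implemented_by_idems A' B' P}"
    using C2_quasi_Cartan_pair C2_infinite_not_implemented by blast
qed

end
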